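(* Let $I\subset\mathbb{R}$ be a compact interval and let $h:I\rightarrow \mathbb{R}$ be a $C^{1}$ function such that $\log h'$ is defined on $I$ (that is, $h'>0$ on $I$) and is of bounded variation on $I$. Then $\log h'$ is of bounded Zygmund variation and of bounded quadratic variation on $I$.
   Context: Let $I\subset\mathbb{R}$ be a compact interval and $\phi:I\to\mathbb{R}$ continuous. $\phi$ is of bounded Zygmund variation on $I$ if there is $B>0$ with $$\sup_{\{x_0,\dots,x_n\}}\sum_{i=0}^{n-1}\left|\phi(x_i)+\phi(x_{i+1})-2\phi\left(\tfrac{x_i+x_{i+1}}{2}\right)\right|\le B,$$ where the supremum is over all partitions $x_0<x_1<\dots<x_n$ of $I$ (with $x_0,x_n$ the endpoints of $I$). $\phi$ is of bounded quadratic variation on $I$ if there is $B>0$ with $$\sup_{\{x_0,\dots,x_n\}}\sum_{i=0}^{n-1}(\phi(x_{i+1})-\phi(x_i))^2\le B,$$ with the supremum over all partitions of $I$. *)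

theory Defs
  imports "HOL-Analysis.Analysis"
begin

definition interval_partition :: "real \<Rightarrow> real \<Rightarrow> nat \<Rightarrow> (nat \<Rightarrow> real) \<Rightarrow> bool" where
  "interval_partition a b n x \<longleftrightarrow>
     x 0 = a \<and> x n = b \<and> (\<forall>i<n. x i < x (Suc i))"

text \<open>
  Bounds on suprema over partitions are stated partition by partition: the supremum of an
  unbounded set of reals is an unspecified number in HOL.
\<close>

definition bounded_variation_on :: "real \<Rightarrow> real \<Rightarrow> (real \<Rightarrow> real) \<Rightarrow> bool" where
  "bounded_variation_on a b \<phi> \<longleftrightarrow>
     (\<exists>B>0. \<forall>n x. interval_partition a b n x \<longrightarrow>
        (\<Sum>i<n. \<bar>\<phi> (x (Suc i)) - \<phi> (x i)\<bar>) \<le> B)"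

text \<open>
  Zygmund and quadratic variation are considered for continuous functions only, so
  continuity is part of the two notions below.
\<close>

definition bounded_Zygmund_variation_on :: "real \<Rightarrow> real \<Rightarrow> (real \<Rightarrow> real) \<Rightarrow> bool" where
  "bounded_Zygmund_variation_on a b \<phi> \<longleftrightarrow>
     continuous_on {a..b} \<phi> \<and>
     (\<exists>B>0. \<forall>n x. interval_partition a b n x \<longrightarrow>
        (\<Sum>i<n. \<bar>\<phi> (x i) + \<phi> (x (Suc i)) - 2 * \<phi> ((x i + x (Suc i)) / 2)\<bar>) \<le> B)"

definition bounded_quadratic_variation_on :: "real \<Rightarrow> real \<Rightarrow> (real \<Rightarrow> real) \<Rightarrow> bool" where
  "bounded_quadratic_variation_on a b \<phi> \<longleftrightarrow>
     continuous_on {a..b} \<phi> \<and>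
     (\<exists>B>0. \<forall>n x. interval_partition a b n x \<longrightarrow>
        (\<Sum>i<n. (\<phi> (x (Suc i)) - \<phi> (x i))\<^sup>2) \<le> B)"

text \<open>
  Derivatives are taken within the interval, hence one-sided at its endpoints;
  \<open>C1_differentiable_on\<close> would require two-sided derivatives there.
\<close>

definition C1_on_interval :: "real \<Rightarrow> real \<Rightarrow> (real \<Rightarrow> real) \<Rightarrow> (real \<Rightarrow> real) \<Rightarrow> bool" where
  "C1_on_interval a b h h' \<longleftrightarrow>
     (\<forall>x\<in>{a..b}. (h has_real_derivative h' x) (at x within {a..b})) \<and>
     continuous_on {a..b} h'"

end

theory Submission
  imports Defs
begin

text \<open>
  Both conclusions hold for every continuous \<open>\<phi>\<close> of variation at most \<open>B\<close>, and \<open>ln \<circ> h'\<close> is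
  such a function because \<open>h'\<close> is continuous and positive. The second difference
  \<open>\<phi> u + \<phi> v - 2 * \<phi> ((u + v) / 2)\<close> is a difference of the two increments of \<open>\<phi>\<close> over the
  halves of \<open>[u, v]\<close>; hence the Zygmund sum of a partition is at most the variation sum of the
  partition refined by all midpoints, and \<open>B\<close> bounds it. Each single increment is at most
  \<open>B\<close> in absolute value, so the quadratic sum is at most \<open>B\<close> times the variation sum,
  that is, at most \<open>B\<^sup>2\<close>.
\<close>

definition midpoint_refinement :: "(nat \<Rightarrow> real) \<Rightarrow> nat \<Rightarrow> real" where
  "midpoint_refinement x j =
     (if even j then x (j div 2) else (x (j div 2) + x (Suc (j div 2))) / 2)"

lemma midpoint_refinement_simps [simp]:
  "midpoint_refinement x (2 * i) = x i"
  "midpoint_refinement x (Suc (2 * i)) = (x i + x (Suc i)) / 2"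
  "midpoint_refinement x (Suc (Suc (2 * i))) = x (Suc i)"
  by (simp_all add: midpoint_refinement_def)

lemma interval_partition_midpoint_refinement:
  assumes "interval_partition a b n x"
  shows "interval_partition a b (2 * n) (midpoint_refinement x)"
  unfolding interval_partition_def
proof (intro conjI allI impI)
  show "midpoint_refinement x 0 = a" and "midpoint_refinement x (2 * n) = b"
    using assms midpoint_refinement_simps(1)[of x 0] by (simp_all add: interval_partition_def)
next
  fix j assume j: "j < 2 * n"
  have less: "x i < x (Suc i)" if "i < n" for i
    using assms that by (simp add: interval_partition_def)
  show "midpoint_refinement x j < midpoint_refinement x (Suc j)"
  proof (cases "even j")
    case True
    then obtain i where i: "j = 2 * i" by (rule evenE)
    with j less[of i] show ?thesis by simp
  next
    case False
    then obtain i where i: "j = Suc (2 * i)" by (auto elim: oddE)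
    with j less[of i] show ?thesis by simp
  qed
qed

lemma sum_lessThan_double:
  fixes f :: "nat \<Rightarrow> 'a::comm_monoid_add"
  shows "(\<Sum>j<2 * n. f j) = (\<Sum>i<n. f (2 * i) + f (Suc (2 * i)))"
  by (induction n) (simp_all add: ac_simps)

lemma bounded_variation_imp_bounded_Zygmund_variation:
  assumes "continuous_on {a..b} \<phi>" and "bounded_variation_on a b \<phi>"
  shows "bounded_Zygmund_variation_on a b \<phi>"
proof -
  obtain B where "B > 0" and B: "\<And>n x. interval_partition a b n x \<Longrightarrow>
      (\<Sum>i<n. \<bar>\<phi> (x (Suc i)) - \<phi> (x i)\<bar>) \<le> B"
    using assms(2) by (auto simp: bounded_variation_on_def)
  have "(\<Sum>i<n. \<bar>\<phi> (x i) + \<phi> (x (Suc i)) - 2 * \<phi> ((x i + x (Suc i)) / 2)\<bar>) \<le> B"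
    if x: "interval_partition a b n x" for n x
  proof -
    let ?y = "midpoint_refinement x"
    have "(\<Sum>i<n. \<bar>\<phi> (x i) + \<phi> (x (Suc i)) - 2 * \<phi> ((x i + x (Suc i)) / 2)\<bar>)
        \<le> (\<Sum>i<n. \<bar>\<phi> ((x i + x (Suc i)) / 2) - \<phi> (x i)\<bar>
                + \<bar>\<phi> (x (Suc i)) - \<phi> ((x i + x (Suc i)) / 2)\<bar>)"
      by (rule sum_mono) linarith
    also have "\<dots> = (\<Sum>j<2 * n. \<bar>\<phi> (?y (Suc j)) - \<phi> (?y j)\<bar>)"
      by (simp add: sum_lessThan_double)
    also have "\<dots> \<le> B"
      by (rule B[OF interval_partition_midpoint_refinement[OF x]])
    finally show ?thesis .
  qed
  with assms(1) \<open>B > 0\<close> show ?thesis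
    by (auto simp: bounded_Zygmund_variation_on_def)
qed

lemma bounded_variation_imp_bounded_quadratic_variation:
  assumes "continuous_on {a..b} \<phi>" and "bounded_variation_on a b \<phi>"
  shows "bounded_quadratic_variation_on a b \<phi>"
proof -
  obtain B where "B > 0" and B: "\<And>n x. interval_partition a b n x \<Longrightarrow>
      (\<Sum>i<n. \<bar>\<phi> (x (Suc i)) - \<phi> (x i)\<bar>) \<le> B"
    using assms(2) by (auto simp: bounded_variation_on_def)
  have "(\<Sum>i<n. (\<phi> (x (Suc i)) - \<phi> (x i))\<^sup>2) \<le> B * B"
    if x: "interval_partition a b n x" for n x
  proof -
    let ?d = "\<lambda>i. \<bar>\<phi> (x (Suc i)) - \<phi> (x i)\<bar>"
    have d_le: "?d i \<le> B" if "i < n" for i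
    proof -
      have "?d i \<le> (\<Sum>i<n. ?d i)"
        using that by (intro member_le_sum) auto
      with B[OF x] show ?thesis by linarith
    qed
    have "(\<Sum>i<n. (\<phi> (x (Suc i)) - \<phi> (x i))\<^sup>2) = (\<Sum>i<n. ?d i * ?d i)"
      by (simp add: power2_eq_square)
    also have "\<dots> \<le> (\<Sum>i<n. B * ?d i)"
      by (intro sum_mono mult_right_mono d_le) auto
    also have "\<dots> = B * (\<Sum>i<n. ?d i)"
      by (simp add: sum_distrib_left)
    also have "\<dots> \<le> B * B"
      using B[OF x] \<open>B > 0\<close> by simp
    finally show ?thesis .
  qed
  moreover have "B * B > 0" using \<open>B > 0\<close> by simp
  ultimately show ?thesis
    using assms(1) unfolding bounded_quadratic_variation_on_def by blast
qed

theorem mainTheorem2: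
  fixes a b :: real and h h' :: "real \<Rightarrow> real"
  assumes "a \<le> b"
    and "C1_on_interval a b h h'"
    and "\<forall>x\<in>{a..b}. h' x > 0"
    and "bounded_variation_on a b (\<lambda>x. ln (h' x))"
  shows "bounded_Zygmund_variation_on a b (\<lambda>x. ln (h' x)) \<and>
         bounded_quadratic_variation_on a b (\<lambda>x. ln (h' x))"
proof -
  have "continuous_on {a..b} h'"
    using assms(2) by (simp add: C1_on_interval_def)
  then have "continuous_on {a..b} (\<lambda>x. ln (h' x))"
    using assms(3) by (intro continuous_on_ln) fastforce+
  with assms(4) show ?thesis
    using bounded_variation_imp_bounded_Zygmund_variation
      bounded_variation_imp_bounded_quadratic_variation by blast
qed

end
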